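(* Let $\mathcal{H}$ be a real Hilbert space, $L_D\ge0$ and $\beta_E\ge0$. Assume that $B:\mathcal{H}\to2^{\mathcal{H}}$, that $D:\mathcal{H}\to\mathcal{H}$ is $L_D$-Lipschitz continuous w.r.t. $\|\cdot\|$, that $E:\mathcal{H}\to\mathcal{H}$ is $\frac1{\beta_E}$-cocoercive w.r.t. $\|\cdot\|$, that $K:\mathcal{H}\to\mathcal{H}$ is linear skew-adjoint, that $B+D$ is maximally monotone, and that $\mathrm{zer}(B+D+E+K):=\{x:0\in Bx+Dx+Ex+Kx\}\ne\emptyset$. Suppose that for some $\epsilon\in(0,1)$ and all $k\in\mathbb{N}$, $\gamma_k\in[\epsilon,\frac1\epsilon]$ and $$\gamma_k\le\frac{4-\epsilon}{\beta_E+\sqrt{\beta_E^2+16(L_D+\|K\|)^2}}.$$ Let $x_0\in\mathcal{H}$ and, for $k=0,1,\ldots$, let $$\hat x_k:=(\mathrm{Id}+\gamma_kB)^{-1}(\mathrm{Id}-\gamma_k(D+K+E))x_k,\qquad x_{k+1}:=\hat x_k-\gamma_k\big((D+K)\hat x_k-(D+K)x_k\big).$$ Then $(x_k)_{k\in\mathbb{N}}$ converges weakly to some $\bar x\in\mathrm{zer}(B+D+E+K)$. Moreover, if $B+D+E+K$ is metrically subregular at all $z\in\mathrm{zer}(B+D+E+K)$ for $0$ and $\mathcal{H}$ is finite-dimensional, then $x_k\to\bar x\in\mathrm{zer}(B+D+E+K)$ locally R-linearly and $\mathrm{dist}(x_k,\mathrm{zer}(B+D+E+K))$ converges locally Q-linearly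 to zero.
   Context: $E$ is $\frac1{\beta_E}$-cocoercive w.r.t. $\|\cdot\|$ if $\langle Ex-Ey,x-y\rangle\ge\frac1{\beta_E}\|Ex-Ey\|^2$ for all $x,y$; for $\beta_E=0$ this means that $E$ is constant. Linear skew-adjoint means bounded, linear, with $K^*=-K$; $\|K\|$ is the operator norm. Convention: $\frac{\alpha}{0}=\infty$ for $\alpha>0$ (so the displayed bound on $\gamma_k$ is void if its denominator is $0$). $\mathrm{dist}(x,H)=\inf_{y\in H}\|x-y\|$ ($+\infty$ if $H=\emptyset$). Metric subregularity: $F:\mathcal{H}\to2^{\mathcal{H}}$ is metrically subregular at $\bar x$ for $\bar y$ if $\bar y\in F\bar x$ and there exist $\kappa\in[0,\infty)$ and neighborhoods $\mathcal{U}$ of $\bar x$ and $\mathcal{V}$ of $\bar y$ such that $\mathrm{dist}(x,F^{-1}\bar y)\le\kappa\,\mathrm{dist}(\bar y,Fx\cap\mathcal{V})$ for all $x\in\mathcal{U}$. A nonnegative sequence $(d_k)$ converges locally Q-linearly to zero if there are $K_0\in\mathbb{N}$ and $c\in[0,1)$ with $d_{k+1}\le c\,d_k$ for all $k\ge K_0$; $x_k\to\bar x$ locally R-linearly if there are $K_0\in\mathbb{N}$, $R\ge0$ and $c\in[0,1)$ with $\|x_k-\bar x\|\le Rc^k$ for all $k\ge K_0$. *)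

theory Defs
  imports "HOL-Analysis.Analysis" "HOL-Library.Set_Algebras"
begin

text \<open>
  A set-valued operator on \<open>H\<close> is a function \<open>'a \<Rightarrow> 'a set\<close>; a single-valued \<open>D\<close> enters
  sums of operators as \<open>\<lambda>x. {D x}\<close>. Sums of sets are the Minkowski sums of the library.
\<close>

definition zer :: "('a::zero \<Rightarrow> 'a set) \<Rightarrow> 'a set" where
  "zer A = {x. 0 \<in> A x}"

definition op_inverse :: "('a \<Rightarrow> 'b set) \<Rightarrow> 'b \<Rightarrow> 'a set" where
  "op_inverse A y = {x. y \<in> A x}"

definition monotone_op :: "('a::real_inner \<Rightarrow> 'a set) \<Rightarrow> bool" where
  "monotone_op A \<longleftrightarrow> (\<forall>x y. \<forall>u\<in>A x. \<forall>v\<in>A y. (u - v) \<bullet> (x - y) \<ge> 0)"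

definition maximally_monotone :: "('a::real_inner \<Rightarrow> 'a set) \<Rightarrow> bool" where
  "maximally_monotone A \<longleftrightarrow>
     monotone_op A \<and> (\<forall>A'. monotone_op A' \<and> (\<forall>x. A x \<subseteq> A' x) \<longrightarrow> A' = A)"

text \<open>The parameter \<open>\<beta>\<close> is the inverse of the cocoercivity constant.\<close>

definition inv_cocoercive :: "real \<Rightarrow> ('a::real_inner \<Rightarrow> 'a) \<Rightarrow> bool" where
  "inv_cocoercive \<beta> E \<longleftrightarrow>
     (if \<beta> = 0 then \<exists>c. \<forall>x. E x = c
      else \<forall>x y. (E x - E y) \<bullet> (x - y) \<ge> (1 / \<beta>) * (norm (E x - E y))\<^sup>2)"

text \<open>
  The library's \<^const>\<open>adjoint\<close> is a choice of a map satisfying the adjoint identity; on a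
  Hilbert space such a map exists and is unique for every bounded linear operator.
\<close>

definition linear_skew_adjoint :: "('a::real_inner \<Rightarrow> 'a) \<Rightarrow> bool" where
  "linear_skew_adjoint K \<longleftrightarrow> bounded_linear K \<and> adjoint K = (\<lambda>x. - K x)"

text \<open>
  \<open>resolvent \<gamma> B z\<close> is the element of \<open>(Id + \<gamma>B)\<inverse> z\<close>; it is meaningful only if that set is
  a singleton.
\<close>

definition resolvent :: "real \<Rightarrow> ('a::real_vector \<Rightarrow> 'a set) \<Rightarrow> 'a \<Rightarrow> 'a" where
  "resolvent \<gamma> B z = the_elem (op_inverse (\<lambda>x. {x} + (\<lambda>u. \<gamma> *\<^sub>R u) ` B x) z)"

text \<open>\<^const>\<open>infdist\<close> is 0 on the empty set, whereas here the distance has to be infinite.\<close>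

definition ext_dist :: "'a::metric_space \<Rightarrow> 'a set \<Rightarrow> ereal" where
  "ext_dist x S = (INF y\<in>S. ereal (dist x y))"

text \<open>
  If \<open>F x \<inter> V\<close> is empty, the inequality below is void for \<open>\<kappa> > 0\<close>. The library's convention
  \<open>0 * \<infinity> = 0\<close> does not affect the notion, since \<open>\<kappa> = 0\<close> can be replaced by \<open>\<kappa> = 1\<close>.
\<close>

definition metrically_subregular ::
  "('a::metric_space \<Rightarrow> 'b::metric_space set) \<Rightarrow> 'a \<Rightarrow> 'b \<Rightarrow> bool" where
  "metrically_subregular F xb yb \<longleftrightarrow>
     yb \<in> F xb \<and>
     (\<exists>\<kappa>::real. \<kappa> \<ge> 0 \<and>
       (\<exists>U V. xb \<in> interior U \<and> yb \<in> interior V \<and>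
         (\<forall>x\<in>U. ext_dist x (op_inverse F yb) \<le> ereal \<kappa> * ext_dist yb (F x \<inter> V))))"

definition weakly_convergent_to :: "(nat \<Rightarrow> 'a::real_inner) \<Rightarrow> 'a \<Rightarrow> bool" where
  "weakly_convergent_to x l \<longleftrightarrow> (\<forall>y. (\<lambda>k. x k \<bullet> y) \<longlonglongrightarrow> l \<bullet> y)"

definition locally_Q_linear_to_zero :: "(nat \<Rightarrow> real) \<Rightarrow> bool" where
  "locally_Q_linear_to_zero d \<longleftrightarrow>
     (\<forall>k. d k \<ge> 0) \<and> (\<exists>K0. \<exists>c\<in>{0..<1}. \<forall>k\<ge>K0. d (Suc k) \<le> c * d k)"

definition locally_R_linear_to :: "(nat \<Rightarrow> 'a::real_normed_vector) \<Rightarrow> 'a \<Rightarrow> bool" where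
  "locally_R_linear_to x l \<longleftrightarrow>
     (\<exists>K0. \<exists>R\<ge>0. \<exists>c\<in>{0..<1}. \<forall>k\<ge>K0. norm (x k - l) \<le> R * c ^ k)"

end

theory Submission
  imports Defs
begin

text \<open>
  With \<open>L = L\<^sub>D + \<parallel>K\<parallel>\<close>, monotonicity of \<open>B + D\<close>, skewness of \<open>K\<close> and cocoercivity of \<open>E\<close>
  give, for every zero \<open>z\<close>, the Fejer estimate
  \<open>\<parallel>x\<^sub>k\<^sub>+\<^sub>1 - z\<parallel>\<^sup>2 \<le> \<parallel>x\<^sub>k - z\<parallel>\<^sup>2 - (1 - \<gamma>\<^sup>2L\<^sup>2 - \<gamma>\<beta>/2) \<parallel>x\<^sub>k - xh\<^sub>k\<parallel>\<^sup>2\<close>, and the step-size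
  bound is \<open>1 - \<epsilon>/4\<close> times the positive root of \<open>\<gamma>\<^sup>2L\<^sup>2 + \<gamma>\<beta>/2 = 1\<close>. Hence the residuals, which
  are elements of the operator at \<open>xh\<^sub>k\<close> of norm \<open>O(\<parallel>x\<^sub>k - xh\<^sub>k\<parallel>)\<close>, vanish; weak cluster points are
  zeros, and Opial's argument applies. Under metric subregularity, the distance to the zeros is
  \<open>O(\<parallel>x\<^sub>k - xh\<^sub>k\<parallel>)\<close>, so taking the infimum over \<open>z\<close> in the Fejer estimate yields Q-linear decay, and
  \<open>\<parallel>x\<^sub>k - xb\<parallel>\<close> is at most twice that distance.
\<close>

section \<open>Minimisation, Riesz representation and weak limits\<close>

text \<open>\<open>t + (norm w)\<^sup>2 / 2\<close> is strongly convex in \<open>w\<close>, so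
  completeness alone gives a minimiser; the conclusion is its first-order optimality condition. With
  \<open>P\<close> a graph this yields Riesz representation, with \<open>P\<close> an epigraph
  Minty's theorem.\<close>

lemma min_norm_epigraph:
  fixes P :: "('b::{real_inner,complete_space} \<times> real) set"
  assumes "P \<noteq> {}" "convex P" "closed P"
    and bdd: "\<And>w t. (w, t) \<in> P \<Longrightarrow> m0 \<le> t + (norm w)\<^sup>2 / 2"
  obtains w0 t0 where "(w0, t0) \<in> P"
    and "\<And>w t. (w, t) \<in> P \<Longrightarrow> t0 + (norm w0)\<^sup>2 \<le> t + w0 \<bullet> w"
proof -
  define h where "h = (\<lambda>p::'b \<times> real. snd p + (norm (fst p))\<^sup>2 / 2)"
  define m where "m = Inf (h ` P)"
  have bdd': "bdd_below (h ` P)"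
    unfolding bdd_below_def h_def using bdd by (intro exI[of _ m0]) auto
  have m_le: "m \<le> h p" if "p \<in> P" for p
    unfolding m_def using bdd' that by (intro cInf_lower) auto
  have "\<exists>p\<in>P. h p < m + 1 / real (Suc n)" for n
  proof -
    have "\<exists>y\<in>h ` P. y < m + 1 / real (Suc n)"
      using \<open>P \<noteq> {}\<close> bdd' unfolding m_def by (intro cInf_lessD) auto
    then show ?thesis by auto
  qed
  then obtain p where pP: "\<And>n. p n \<in> P" and hp: "\<And>n. h (p n) < m + 1 / real (Suc n)"
    by metis
  define w where "w = (\<lambda>n. fst (p n))"
  \<comment> \<open>Parallelogram identity at the midpoint: near-minimisers have nearby first
    components.\<close>
  have mid: "(norm (fst a - fst b))\<^sup>2 / 8 \<le> (h a + h b) / 2 - m" if "a \<in> P" "b \<in> P" for a b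
  proof -
    have "(1/2) *\<^sub>R a + (1/2) *\<^sub>R b \<in> P"
      using \<open>convex P\<close> that by (auto simp: convex_def)
    then have "m \<le> h ((1/2) *\<^sub>R a + (1/2) *\<^sub>R b)" by (rule m_le)
    also have "\<dots> = (h a + h b) / 2 - (norm (fst a - fst b))\<^sup>2 / 8"
      unfolding h_def power2_norm_eq_inner
      by (simp add: inner_simps inner_commute field_simps)
    finally show ?thesis by argo
  qed
  have close: "(norm (w i - w j))\<^sup>2 \<le> 8 * (1 / real (Suc n))" if "n \<le> i" "n \<le> j" for i j n
  proof -
    have "1 / real (Suc i) \<le> 1 / real (Suc n)" "1 / real (Suc j) \<le> 1 / real (Suc n)"
      using that by (auto intro!: divide_left_mono)
    then show ?thesis using mid[OF pP[of i] pP[of j]] hp[of i] hp[of j] unfolding w_def by argo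
  qed
  have "Cauchy w"
  proof (rule metric_CauchyI)
    fix e :: real assume "0 < e"
    then obtain n where n: "8 / e\<^sup>2 < real n" using reals_Archimedean2 by blast
    have n': "8 * (1 / real (Suc n)) < e\<^sup>2"
    proof -
      have "8 < real n * e\<^sup>2" using n \<open>0 < e\<close> by (simp add: field_simps)
      also have "\<dots> \<le> real (Suc n) * e\<^sup>2" by (intro mult_right_mono) auto
      finally show ?thesis by (simp add: field_simps)
    qed
    have "dist (w i) (w j) < e" if "n \<le> i" "n \<le> j" for i j
      unfolding dist_norm
      using power2_less_imp_less[OF le_less_trans[OF close[OF that] n']] \<open>0 < e\<close> by simp
    then show "\<exists>M. \<forall>i\<ge>M. \<forall>j\<ge>M. dist (w i) (w j) < e" by (intro exI[of _ n]) simp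
  qed
  then obtain w0 where w0: "w \<longlonglongrightarrow> w0" using Cauchy_convergent_iff convergent_def by blast
  have hlim: "(\<lambda>n. h (p n)) \<longlonglongrightarrow> m"
  proof (rule tendsto_sandwich)
    show "\<forall>\<^sub>F n in sequentially. m \<le> h (p n)" using m_le pP by auto
    show "\<forall>\<^sub>F n in sequentially. h (p n) \<le> m + 1 / real (Suc n)"
      using hp by (auto intro!: always_eventually less_imp_le)
    show "(\<lambda>n. m + 1 / real (Suc n)) \<longlonglongrightarrow> m"
      using tendsto_add[OF tendsto_const LIMSEQ_inverse_real_of_nat, of m]
      by (simp add: inverse_eq_divide)
  qed auto
  \<comment> \<open>The second components converge because \<open>h (p n)\<close> and
    \<open>w n\<close> do, and \<open>t0\<close> is the limit this forces.\<close>
  define t0 where "t0 = m - (norm w0)\<^sup>2 / 2"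
  have "(\<lambda>n. h (p n) - (norm (w n))\<^sup>2 / 2) \<longlonglongrightarrow> t0"
    unfolding t0_def by (intro tendsto_intros hlim w0) auto
  then have "(\<lambda>n. snd (p n)) \<longlonglongrightarrow> t0" by (simp add: h_def w_def)
  from tendsto_Pair[OF w0 this] have "p \<longlonglongrightarrow> (w0, t0)" by (simp add: w_def)
  with pP have in_P: "(w0, t0) \<in> P" by (rule closed_sequentially[OF \<open>closed P\<close>])
  have "t0 + (norm w0)\<^sup>2 \<le> t + w0 \<bullet> w" if "(w, t) \<in> P" for w t
  proof -
    \<comment> \<open>On the segment towards \<open>(w, t)\<close>, \<open>h\<close> equals
      \<open>m + s * (b + s * a)\<close>; dividing by \<open>s\<close> and letting \<open>s\<close>
      decrease to 0 leaves \<open>0 \<le> b\<close>.\<close>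
    define b where "b = t - t0 + w0 \<bullet> (w - w0)"
    define a where "a = (norm (w - w0))\<^sup>2 / 2"
    have lin: "0 \<le> b + s * a" if s: "0 < s" "s \<le> 1" for s
    proof -
      have "(1 - s) *\<^sub>R (w0, t0) + s *\<^sub>R (w, t) \<in> P"
        using s by (intro convexD_alt[OF \<open>convex P\<close> in_P \<open>(w, t) \<in> P\<close>]) auto
      then have "m \<le> h ((1 - s) *\<^sub>R (w0, t0) + s *\<^sub>R (w, t))" by (rule m_le)
      also have "\<dots> = m + s * (b + s * a)"
        unfolding h_def a_def b_def t0_def power2_norm_eq_inner
        by (simp add: inner_simps inner_commute field_simps)
      finally have "0 \<le> s * (b + s * a)" by simp
      with s show ?thesis by (simp add: zero_le_mult_iff)
    qed
    have "((\<lambda>s. b + s * a) \<longlongrightarrow> b + 0 * a) (at_right 0)" by (intro tendsto_intros)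
    moreover have "\<forall>\<^sub>F s in at_right 0. 0 \<le> b + s * a"
      unfolding eventually_at_right_field using lin by (intro exI[of _ 1]) auto
    ultimately have "0 \<le> b" by (metis add.right_neutral mult_zero_left tendsto_lowerbound trivial_limit_at_right_real)
    then show ?thesis by (simp add: b_def inner_simps power2_norm_eq_inner)
  qed
  with in_P show ?thesis using that by blast
qed

text \<open>The representing vector minimises \<open>(norm w)\<^sup>2 / 2 - f w\<close>. Optimality
  tested at \<open>w0 + y\<close> gives \<open>f y \<le> w0 \<bullet> y\<close>, and
  \<open>- y\<close> reverses the inequality.\<close>

lemma riesz_representation:
  fixes f :: "'a::{real_inner,complete_space} \<Rightarrow> real"
  assumes "bounded_linear f"
  obtains l where "\<And>y. f y = l \<bullet> y"
proof -
  interpret bounded_linear f by fact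
  define P where "P = {p. f (fst p) + snd p = 0}"
  have low: "- (onorm f)\<^sup>2 / 2 \<le> t + (norm w)\<^sup>2 / 2" if "f w + t = 0" for w t
  proof -
    have "f w \<le> onorm f * norm w" using onorm[OF assms, of w] by simp
    with sum_squares_bound[of "onorm f" "norm w"] that show ?thesis by simp
  qed
  obtain w0 t0 where w0: "(w0, t0) \<in> P"
    and opt: "\<And>w t. (w, t) \<in> P \<Longrightarrow> t0 + (norm w0)\<^sup>2 \<le> t + w0 \<bullet> w"
  proof (rule min_norm_epigraph[of P "- (onorm f)\<^sup>2 / 2"])
    have "(0, 0) \<in> P" by (simp add: P_def zero)
    then show "P \<noteq> {}" by blast
    show "convex P" proof (rule convexI)
      fix p q :: "'a \<times> real" and u v :: real
      assume "p \<in> P" "q \<in> P"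
      then have "u * (f (fst p) + snd p) + v * (f (fst q) + snd q) = 0" by (simp add: P_def)
      then show "u *\<^sub>R p + v *\<^sub>R q \<in> P" by (simp add: P_def add scaleR algebra_simps)
    qed
    show "closed P" unfolding P_def
      by (intro closed_Collect_eq continuous_intros continuous_on[of UNIV fst])
  qed (use low in \<open>auto simp: P_def\<close>)
  have le: "f y \<le> w0 \<bullet> y" for y
    using opt[of "w0 + y" "- f (w0 + y)"] w0
    by (simp add: P_def add inner_simps power2_norm_eq_inner)
  have "f y = w0 \<bullet> y" for y
    using le[of y] le[of "- y"] by (simp add: neg)
  then show ?thesis using that by blast
qed

section \<open>Weak cluster points and Opial's lemma\<close>

text \<open>
  Filters replace subsequences: a cluster point of the functionals \<open>\<lambda>y. x i \<bullet> y\<close> exists by Tychonoff's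
  theorem in the product topology, and it is represented by a vector.
\<close>

lemma bounded_weak_cluster_point:
  fixes x :: "'i \<Rightarrow> 'a::{real_inner,complete_space}"
  assumes "F \<noteq> bot" and bdd: "\<And>i. norm (x i) \<le> R"
  obtains G l where "G \<le> F" "G \<noteq> bot" "\<And>y. ((\<lambda>i. x i \<bullet> y) \<longlongrightarrow> l \<bullet> y) G"
proof -
  define X where "X = (\<lambda>i y. x i \<bullet> y)"
  define U where "U = (\<Pi>\<^sub>E y\<in>(UNIV::'a set). {- (R * norm y)..R * norm y})"
  have "compact U"
    using compactin_PiE[of "\<lambda>_. euclidean" UNIV "\<lambda>y::'a. {- (R * norm y)..R * norm y}"]
    by (simp add: U_def euclidean_product_topology compactin_euclidean_iff)
  have XU: "X i \<in> U" for i
  proof -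
    have "\<bar>x i \<bullet> y\<bar> \<le> R * norm y" for y
      using Cauchy_Schwarz_ineq2[of "x i" y] mult_right_mono[OF bdd[of i], of "norm y"] by simp
    then show ?thesis by (auto simp: U_def X_def PiE_iff abs_le_iff minus_le_iff)
  qed
  have "filtermap X F \<noteq> bot" using \<open>F \<noteq> bot\<close> by (simp add: filtermap_bot_iff)
  moreover have "\<forall>\<^sub>F g in filtermap X F. g \<in> U" using XU by (simp add: eventually_filtermap)
  ultimately obtain \<phi> where "\<phi> \<in> U" and clus: "inf (nhds \<phi>) (filtermap X F) \<noteq> bot"
    using \<open>compact U\<close> unfolding compact_filter by blast
  \<comment> \<open>The largest filter below \<open>F\<close> along which \<open>X\<close> tends to
    \<open>\<phi>\<close>; it is proper because \<open>\<phi>\<close> is a cluster point of the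
    image filter.\<close>
  define G where "G = inf F (filtercomap X (nhds \<phi>))"
  have "G \<noteq> bot"
  proof
    assume "G = bot"
    then obtain P Q where PQ: "eventually P F" "eventually Q (nhds \<phi>)" "\<And>i. P i \<Longrightarrow> Q (X i) \<Longrightarrow> False"
      unfolding trivial_limit_def G_def eventually_inf eventually_filtercomap by blast
    have "\<forall>\<^sub>F g in filtermap X F. \<not> Q g"
      unfolding eventually_filtermap using PQ(1) by (rule eventually_mono) (use PQ(3) in blast)
    then have "eventually (\<lambda>_. False) (inf (nhds \<phi>) (filtermap X F))"
      unfolding eventually_inf using PQ(2) by blast
    with clus show False by (simp add: trivial_limit_def)
  qed
  have "filterlim X (nhds \<phi>) G"
    unfolding G_def by (rule filterlim_mono[OF filterlim_filtercomap]) auto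
  then have lim: "((\<lambda>i. x i \<bullet> y) \<longlongrightarrow> \<phi> y) G" for y
    using continuous_on_tendsto_compose[OF continuous_on_product_coordinates[of y], of X \<phi> G]
    by (simp add: X_def)
  \<comment> \<open>Linearity passes to pointwise limits along \<open>G\<close>; the bound is
    membership in the box \<open>U\<close>.\<close>
  have "bounded_linear \<phi>"
  proof (rule bounded_linear_intro)
    show "\<phi> (y + z) = \<phi> y + \<phi> z" for y z
      using tendsto_unique[OF \<open>G \<noteq> bot\<close> lim[of "y + z"]] tendsto_add[OF lim[of y] lim[of z]]
      by (simp add: inner_simps)
    show "\<phi> (r *\<^sub>R y) = r *\<^sub>R \<phi> y" for r y
      using tendsto_unique[OF \<open>G \<noteq> bot\<close> lim[of "r *\<^sub>R y"]] tendsto_mult[OF tendsto_const lim[of y], of r]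
      by simp
    show "norm (\<phi> y) \<le> norm y * R" for y
      using \<open>\<phi> \<in> U\<close> by (auto simp: U_def PiE_iff abs_le_iff mult.commute minus_le_iff)
  qed
  then obtain l where "\<And>y. \<phi> y = l \<bullet> y" by (rule riesz_representation) blast
  with lim \<open>G \<noteq> bot\<close> that[of G l] show ?thesis by (simp add: G_def)
qed

text \<open>Fejer monotonicity makes every \<open>norm (x k - z)\<close> converge, which leaves room
  for only one weak cluster point in \<open>Z\<close>; boundedness supplies it. Cluster points are
  limits along filters below \<open>sequentially\<close>, to match the compactness argument.\<close>

lemma opial:
  fixes x :: "nat \<Rightarrow> 'a::{real_inner,complete_space}"
  assumes "Z \<noteq> {}"
    and fejer: "\<And>z k. z \<in> Z \<Longrightarrow> norm (x (Suc k) - z) \<le> norm (x k - z)"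
    and cluster: "\<And>G l. G \<le> sequentially \<Longrightarrow> G \<noteq> bot \<Longrightarrow>
      (\<And>y. ((\<lambda>k. x k \<bullet> y) \<longlongrightarrow> l \<bullet> y) G) \<Longrightarrow> l \<in> Z"
  obtains xb where "xb \<in> Z" "weakly_convergent_to x xb"
proof -
  have conv: "convergent (\<lambda>k. norm (x k - z))" if "z \<in> Z" for z
    using fejer[OF that]
    by (intro Bseq_monoseq_convergent decseq_imp_monoseq decseq_SucI BseqI'[of _ "norm (x 0 - z)"])
      (auto intro: lift_Suc_antimono_le[where f = "\<lambda>k. norm (x k - z)" and n = 0])
  obtain z0 where "z0 \<in> Z" using assms(1) by blast
  have "Bseq (\<lambda>k. norm (x k - z0))" using conv[OF \<open>z0 \<in> Z\<close>] by (rule convergent_imp_Bseq)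
  then obtain R where R: "\<And>k. norm (x k - z0) \<le> R" by (auto simp: Bseq_def)
  have bdd: "norm (x k) \<le> R + norm z0" for k
    using R[of k] norm_triangle_ineq[of "x k - z0" z0] by simp
  have uniq: "a = b" if "a \<in> Z" "b \<in> Z"
    and G: "G \<le> sequentially" "G \<noteq> bot" "\<And>y. ((\<lambda>k. x k \<bullet> y) \<longlongrightarrow> a \<bullet> y) G"
    and H: "H \<le> sequentially" "H \<noteq> bot" "\<And>y. ((\<lambda>k. x k \<bullet> y) \<longlongrightarrow> b \<bullet> y) H" for a b G H
  proof -
    obtain la lb where la: "(\<lambda>k. norm (x k - a)) \<longlonglongrightarrow> la" and lb: "(\<lambda>k. norm (x k - b)) \<longlonglongrightarrow> lb"
      using conv \<open>a \<in> Z\<close> \<open>b \<in> Z\<close> unfolding convergent_def by blast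
    \<comment> \<open>The difference of the squared distances to \<open>a\<close> and
      \<open>b\<close> is affine in \<open>x k\<close>, so \<open>x k \<bullet> (a - b)\<close>
      converges along the whole sequence and both cluster values agree.\<close>
    have eq: "x k \<bullet> (a - b) = ((norm (x k - b))\<^sup>2 - (norm (x k - a))\<^sup>2 + (norm a)\<^sup>2 - (norm b)\<^sup>2) / 2" for k
      unfolding power2_norm_eq_inner by (simp add: inner_simps inner_commute)
    have lim: "(\<lambda>k. x k \<bullet> (a - b)) \<longlonglongrightarrow> (lb\<^sup>2 - la\<^sup>2 + (norm a)\<^sup>2 - (norm b)\<^sup>2) / 2"
      unfolding eq by (intro tendsto_intros la lb) auto
    have "a \<bullet> (a - b) = b \<bullet> (a - b)"
      using tendsto_unique[OF G(2) G(3) tendsto_mono[OF G(1) lim]]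
        tendsto_unique[OF H(2) H(3) tendsto_mono[OF H(1) lim]] by simp
    then have "(a - b) \<bullet> (a - b) = 0" by (simp add: inner_diff_left)
    then show "a = b" by simp
  qed
  obtain G xb where G: "G \<le> sequentially" "G \<noteq> bot" "\<And>y. ((\<lambda>k. x k \<bullet> y) \<longlongrightarrow> xb \<bullet> y) G"
    using bounded_weak_cluster_point[of sequentially x, OF _ bdd] by auto
  then have "xb \<in> Z" by (rule cluster)
  have "(\<lambda>k. x k \<bullet> y) \<longlonglongrightarrow> xb \<bullet> y" for y
  proof (rule ccontr)
    assume "\<not> (\<lambda>k. x k \<bullet> y) \<longlonglongrightarrow> xb \<bullet> y"
    then obtain e where "0 < e" and freq: "\<not> (\<forall>\<^sub>F k in sequentially. dist (x k \<bullet> y) (xb \<bullet> y) < e)"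
      unfolding tendsto_iff by blast
    \<comment> \<open>The indices staying \<open>e\<close> away from the limit occur frequently, so
      restricting to them gives a proper filter. A weak cluster point below it must again be
      \<open>xb\<close>, which is impossible at \<open>y\<close>.\<close>
    define N where "N = {k. \<not> dist (x k \<bullet> y) (xb \<bullet> y) < e}"
    define F where "F = inf sequentially (principal N)"
    have "F \<noteq> bot" using freq
      by (simp add: F_def N_def trivial_limit_def eventually_inf_principal)
    then obtain H l where H: "H \<le> F" "H \<noteq> bot" "\<And>y. ((\<lambda>k. x k \<bullet> y) \<longlongrightarrow> l \<bullet> y) H"
      using bounded_weak_cluster_point[of F x, OF _ bdd] by auto
    have "H \<le> sequentially" using H(1) by (simp add: F_def)
    with H have "l \<in> Z" using cluster by blast
    with \<open>xb \<in> Z\<close> G H \<open>H \<le> sequentially\<close> have "l = xb" using uniq by blast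
    with H(3) \<open>0 < e\<close> have "\<forall>\<^sub>F k in H. dist (x k \<bullet> y) (xb \<bullet> y) < e" unfolding tendsto_iff by blast
    moreover have "\<forall>\<^sub>F k in H. \<not> dist (x k \<bullet> y) (xb \<bullet> y) < e"
      using H(1) by (rule filter_leD) (simp add: F_def N_def eventually_inf_principal)
    ultimately have "\<forall>\<^sub>F k in H. False" by eventually_elim simp
    with H(2) show False by (simp add: trivial_limit_def)
  qed
  with \<open>xb \<in> Z\<close> show ?thesis using that by (auto simp: weakly_convergent_to_def)
qed

text \<open>Coordinates with respect to a finite orthogonal spanning set are scaled inner products,
  so weak convergence makes each of them converge.\<close>

lemma weak_imp_strong_finite_span:
  fixes x :: "nat \<Rightarrow> 'a::real_inner"
  assumes "finite S" "span S = (UNIV::'a set)" "weakly_convergent_to x l"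
  shows "x \<longlonglongrightarrow> l"
proof -
  obtain C where C: "finite C" "span C = (UNIV::'a set)" "pairwise orthogonal C"
    using basis_orthogonal[OF assms(1)] assms(2) by metis
  define p where "p = (\<lambda>v. \<Sum>c\<in>C. (v \<bullet> c / (c \<bullet> c)) *\<^sub>R c)"
  have p: "p v = v" for v
  proof -
    have "orthogonal (v - p v) c" if "c \<in> C" for c
    proof -
      have "p v \<bullet> c = (\<Sum>d\<in>C. v \<bullet> d / (d \<bullet> d) * (d \<bullet> c))"
        by (simp add: p_def inner_sum_left)
      \<comment> \<open>A zero vector in \<open>C\<close> is harmless: for \<open>d = c = 0\<close>
        both summands are 0.\<close>
      also have "\<dots> = (\<Sum>d\<in>C. if d = c then v \<bullet> c else 0)"
        using C(3) that by (intro sum.cong) (auto simp: pairwise_def orthogonal_def)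
      also have "\<dots> = v \<bullet> c" using C(1) that by simp
      finally show ?thesis by (simp add: orthogonal_def inner_diff_left)
    qed
    then have "orthogonal (v - p v) (v - p v)"
      using C(2) orthogonal_to_span[of "v - p v" C] by simp
    then show ?thesis by (simp add: orthogonal_self)
  qed
  have "(\<lambda>k. (x k \<bullet> c / (c \<bullet> c)) *\<^sub>R c) \<longlonglongrightarrow> (l \<bullet> c / (c \<bullet> c)) *\<^sub>R c" for c
    using assms(3) unfolding weakly_convergent_to_def divide_inverse
    by (intro tendsto_scaleR tendsto_mult tendsto_const) auto
  then have "(\<lambda>k. p (x k)) \<longlonglongrightarrow> p l"
    unfolding p_def by (intro tendsto_sum)
  then show ?thesis by (simp add: p)
qed

section \<open>Minty's theorem\<close>

text \<open>
  The set \<open>P\<close> below is the epigraph of the Fitzpatrick function of \<open>G\<close>, which dominates the duality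
  pairing by maximality. If \<open>(x, u)\<close> minimises the Fitzpatrick function plus half the squared norm, the
  optimality condition shows that \<open>(-u, -x)\<close> is monotonically related to \<open>G\<close>, and then \<open>u = -x\<close>.
\<close>

lemma maximal_monotone_graph_meets_antidiagonal:
  fixes G :: "('a::{real_inner,complete_space} \<times> 'a) set"
  assumes mono: "\<And>x u y v. (x, u) \<in> G \<Longrightarrow> (y, v) \<in> G \<Longrightarrow> 0 \<le> (u - v) \<bullet> (x - y)"
    and maxi: "\<And>x u. (\<And>y v. (y, v) \<in> G \<Longrightarrow> 0 \<le> (u - v) \<bullet> (x - y)) \<Longrightarrow> (x, u) \<in> G"
  obtains x where "(x, - x) \<in> G"
proof -
  \<comment> \<open>An intersection of closed half-spaces, one per \<open>(y, v)\<close> in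
    \<open>G\<close>, is closed and convex at once; the components are swapped because the pairing
    is \<open>v \<bullet> x + y \<bullet> u\<close>.\<close>
  define P :: "(('a \<times> 'a) \<times> real) set"
    where "P = (\<Inter>g\<in>G. {p. ((snd g, fst g), - 1) \<bullet> p \<le> snd g \<bullet> fst g})"
  have P_iff: "((x, u), t) \<in> P \<longleftrightarrow> (\<forall>(y, v)\<in>G. v \<bullet> x + y \<bullet> u - v \<bullet> y \<le> t)" for x u t
    by (fastforce simp: P_def algebra_simps)
  have graph_P: "((x, u), u \<bullet> x) \<in> P" if "(x, u) \<in> G" for x u
    using mono[OF that] by (auto simp: P_iff inner_simps inner_commute algebra_simps)
  have fitz: "u \<bullet> x \<le> t" if "((x, u), t) \<in> P" for x u t
  proof (cases "(x, u) \<in> G")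
    case True
    with that show ?thesis by (auto simp: P_iff inner_commute)
  next
    case False
    then obtain y v where "(y, v) \<in> G" "(u - v) \<bullet> (x - y) < 0" using maxi by (meson not_le)
    with that show ?thesis by (force simp: P_iff inner_simps inner_commute)
  qed
  have pairs: "(norm (w::'a \<times> 'a))\<^sup>2 = (norm (fst w))\<^sup>2 + (norm (snd w))\<^sup>2" for w
    unfolding power2_norm_eq_inner by (simp add: inner_prod_def)
  have low: "0 \<le> t + (norm w)\<^sup>2 / 2" if "(w, t) \<in> P" for w t
  proof -
    have "0 \<le> (norm (fst w + snd w))\<^sup>2" by simp
    also have "\<dots> = (norm w)\<^sup>2 + 2 * (snd w \<bullet> fst w)"
      unfolding pairs power2_norm_eq_inner by (simp add: inner_simps inner_commute)
    finally show ?thesis using fitz[of "fst w" "snd w" t] that by simp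
  qed
  obtain w0 t0 where w0: "(w0, t0) \<in> P"
    and opt: "\<And>w t. (w, t) \<in> P \<Longrightarrow> t0 + (norm w0)\<^sup>2 \<le> t + w0 \<bullet> w"
  proof (rule min_norm_epigraph[of P 0])
    have "G \<noteq> {}" using maxi[of 0 0] by auto
    then show "P \<noteq> {}" using graph_P by auto
    show "convex P" unfolding P_def by (intro convex_INT convex_halfspace_le)
    show "closed P" unfolding P_def by (intro closed_INT ballI closed_halfspace_le)
  qed (use low in auto)
  obtain x u where xu: "w0 = (x, u)" by (cases w0)
  \<comment> \<open>Optimality tested at a graph point, together with
    \<open>u \<bullet> x \<le> t0\<close>, rearranges to this product.\<close>
  have ge: "(norm (x + u))\<^sup>2 \<le> (- x - v) \<bullet> (- u - y)" if "(y, v) \<in> G" for y v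
    using opt[OF graph_P[OF that]] fitz[of x u t0] w0
    unfolding xu pairs power2_norm_eq_inner
    by (simp add: inner_simps inner_commute)
  have "(- u, - x) \<in> G"
    using ge by (intro maxi) (meson order_trans zero_le_power2)
  \<comment> \<open>At this point of \<open>G\<close> the right side of \<open>ge\<close> is
    0.\<close>
  with ge[of "- u" "- x"] have "x + u = 0" by simp
  then have "u = - x" by (simp add: eq_neg_iff_add_eq_0 add.commute)
  with \<open>(- u, - x) \<in> G\<close> show ?thesis using that by simp
qed

text \<open>Adjoining \<open>u\<close> to \<open>T x\<close> keeps the operator monotone, so
  maximality forces \<open>u\<close> to be there already.\<close>

lemma maximally_monotoneD:
  assumes "maximally_monotone T" "\<And>y v. v \<in> T y \<Longrightarrow> 0 \<le> (u - v) \<bullet> (x - y)"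
  shows "u \<in> T x"
proof -
  have mono: "monotone_op T"
    and maxi: "\<And>A'. monotone_op A' \<Longrightarrow> (\<And>x. T x \<subseteq> A' x) \<Longrightarrow> A' = T"
    using assms(1) by (auto simp: maximally_monotone_def)
  have sym: "0 \<le> (v - u) \<bullet> (y - x)" if "v \<in> T y" for y v
    using assms(2)[OF that] by (simp add: inner_simps)
  have "monotone_op (T(x := insert u (T x)))"
    using mono assms(2) sym by (auto simp: monotone_op_def)
  then have "T(x := insert u (T x)) = T" by (rule maxi) auto
  then show ?thesis by (metis fun_upd_same insertI1)
qed

text \<open>\<open>G\<close> is the graph of \<open>\<mu> T - z\<close>, which inherits maximality
  from \<open>T\<close>; its point \<open>(x, - x)\<close> says that \<open>z\<close> lies in
  \<open>x + \<mu> T x\<close>.\<close>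

lemma minty:
  fixes T :: "'a::{real_inner,complete_space} \<Rightarrow> 'a set"
  assumes "maximally_monotone T" "0 < \<mu>"
  obtains p w where "w \<in> T p" "p + \<mu> *\<^sub>R w = z"
proof -
  define G where "G = {(p, v). (1 / \<mu>) *\<^sub>R (v + z) \<in> T p}"
  have T: "0 \<le> (u - v) \<bullet> (x - y)" if "u \<in> T x" "v \<in> T y" for x y u v
    using assms(1) that by (auto simp: maximally_monotone_def monotone_op_def)
  obtain x where "(x, - x) \<in> G"
  proof (rule maximal_monotone_graph_meets_antidiagonal[of G])
    fix x u y v assume "(x, u) \<in> G" "(y, v) \<in> G"
    then have "0 \<le> ((1 / \<mu>) *\<^sub>R (u + z) - (1 / \<mu>) *\<^sub>R (v + z)) \<bullet> (x - y)"
      by (auto simp: G_def intro!: T)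
    also have "\<dots> = (1 / \<mu>) * ((u - v) \<bullet> (x - y))"
      by (simp flip: scaleR_diff_right)
    finally show "0 \<le> (u - v) \<bullet> (x - y)" using \<open>0 < \<mu>\<close> by (simp add: zero_le_divide_iff)
  next
    fix x u assume rel: "\<And>y v. (y, v) \<in> G \<Longrightarrow> 0 \<le> (u - v) \<bullet> (x - y)"
    have "0 \<le> ((1 / \<mu>) *\<^sub>R (u + z) - v) \<bullet> (x - y)" if "v \<in> T y" for y v
    proof -
      have "0 \<le> (u - (\<mu> *\<^sub>R v - z)) \<bullet> (x - y)"
        using that \<open>0 < \<mu>\<close> by (intro rel) (simp add: G_def)
      also have "u - (\<mu> *\<^sub>R v - z) = \<mu> *\<^sub>R ((1 / \<mu>) *\<^sub>R (u + z) - v)"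
        using \<open>0 < \<mu>\<close> by (simp add: scaleR_diff_right)
      finally show ?thesis using \<open>0 < \<mu>\<close> by (simp add: zero_le_mult_iff)
    qed
    then show "(x, u) \<in> G" using maximally_monotoneD[OF assms(1)] by (simp add: G_def)
  qed
  then show ?thesis using that[of "(1 / \<mu>) *\<^sub>R (- x + z)" x] \<open>0 < \<mu>\<close> by (simp add: G_def)
qed

section \<open>Resolvents under Lipschitz perturbations\<close>

text \<open>The resolvent \<open>J\<close> of \<open>\<mu> T\<close> is nonexpansive, so mapping
  \<open>p\<close> to \<open>J (z - C p)\<close> is a contraction and has a fixed point. This serves
  with \<open>C = - \<gamma> D\<close> to pass from \<open>B + D\<close> to \<open>B\<close>, and
  with a multiple of \<open>E + K\<close> to identify weak limits.\<close>

lemma minty_lipschitz: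
  fixes T :: "'a::{real_inner,complete_space} \<Rightarrow> 'a set"
  assumes "maximally_monotone T" "0 < \<mu>" "0 \<le> c" "c < 1"
    and lip: "\<And>x y. norm (C x - C y) \<le> c * norm (x - y)"
  obtains p w where "w \<in> T p" "p + \<mu> *\<^sub>R w + C p = z"
proof -
  have "\<forall>y. \<exists>p w. w \<in> T p \<and> p + \<mu> *\<^sub>R w = y"
    using minty[OF assms(1,2)] by metis
  then obtain J W where W: "\<And>y. W y \<in> T (J y)" and J: "\<And>y. J y + \<mu> *\<^sub>R W y = y"
    by metis
  have nonexp: "norm (J a - J b) \<le> norm (a - b)" for a b
  proof -
    have "0 \<le> (W a - W b) \<bullet> (J a - J b)"
      using W assms(1) by (auto simp: maximally_monotone_def monotone_op_def)
    then have "0 \<le> (\<mu> *\<^sub>R (W a - W b)) \<bullet> (J a - J b)" using \<open>0 < \<mu>\<close> by simp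
    also have "\<mu> *\<^sub>R (W a - W b) = (a - b) - (J a - J b)"
      using J[of a] J[of b] by (simp add: algebra_simps)
    finally have "norm (J a - J b) * norm (J a - J b) \<le> (a - b) \<bullet> (J a - J b)"
      by (simp add: inner_diff_left flip: power2_norm_eq_inner power2_eq_square)
    also have "\<dots> \<le> norm (a - b) * norm (J a - J b)" by (rule norm_cauchy_schwarz)
    finally show ?thesis
      by (cases "norm (J a - J b) = 0") (auto simp: mult_le_cancel_right)
  qed
  have "\<exists>!p. J (z - C p) = p"
  proof (rule banach_fix_type[OF \<open>0 \<le> c\<close> \<open>c < 1\<close>], intro allI)
    fix x y
    have "norm (J (z - C x) - J (z - C y)) \<le> norm (C x - C y)"
      using nonexp[of "z - C x" "z - C y"] by (simp add: norm_minus_commute)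
    also have "\<dots> \<le> c * norm (x - y)" by (rule lip)
    finally show "dist (J (z - C x)) (J (z - C y)) \<le> c * dist x y" by (simp add: dist_norm)
  qed
  then obtain p where "J (z - C p) = p" by blast
  then show ?thesis using that[of "W (z - C p)" p] W[of "z - C p"] J[of "z - C p"]
    by (simp add: algebra_simps)
qed

text \<open>Monotonicity is assumed of \<open>B + D\<close> only, but
  \<open>\<gamma> * L < 1\<close> still makes the resolvent set of \<open>B\<close> a singleton, so
  that \<open>the_elem\<close> is meaningful.\<close>

lemma resolvent_hypomonotone:
  fixes B :: "'a::{real_inner,complete_space} \<Rightarrow> 'a set"
  assumes max: "maximally_monotone (\<lambda>x. B x + {D x})"
    and lip: "\<And>x y. norm (D x - D y) \<le> L * norm (x - y)"
    and "0 \<le> L" "0 < \<gamma>" "\<gamma> * L < 1"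
  shows "(1 / \<gamma>) *\<^sub>R (z - resolvent \<gamma> B z) \<in> B (resolvent \<gamma> B z)"
proof -
  let ?R = "op_inverse (\<lambda>x. {x} + (\<lambda>u. \<gamma> *\<^sub>R u) ` B x) z"
  have R_iff: "p \<in> ?R \<longleftrightarrow> (1 / \<gamma>) *\<^sub>R (z - p) \<in> B p" for p
  proof -
    have "p \<in> ?R \<longleftrightarrow> (\<exists>u\<in>B p. z = p + \<gamma> *\<^sub>R u)"
      by (auto simp: op_inverse_def set_plus_def)
    also have "\<dots> \<longleftrightarrow> (1 / \<gamma>) *\<^sub>R (z - p) \<in> B p" using \<open>0 < \<gamma>\<close> by (auto intro!: bexI)
    finally show ?thesis .
  qed
  \<comment> \<open>The perturbation \<open>- \<gamma> D\<close> cancels the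
    \<open>\<gamma> D\<close> contained in \<open>\<gamma> w\<close>, so \<open>p\<close> solves the
    inclusion for \<open>B\<close> alone.\<close>
  obtain p w where p: "w \<in> B p + {D p}" "p + \<gamma> *\<^sub>R w + (- \<gamma> *\<^sub>R D p) = z"
  proof (rule minty_lipschitz[OF max \<open>0 < \<gamma>\<close>, of "\<gamma> * L" "\<lambda>p. - \<gamma> *\<^sub>R D p"])
    fix x y
    have "norm (- \<gamma> *\<^sub>R D x - - \<gamma> *\<^sub>R D y) = \<gamma> * norm (D x - D y)"
      using \<open>0 < \<gamma>\<close> by (simp add: norm_minus_commute flip: scaleR_diff_right)
    then show "norm (- \<gamma> *\<^sub>R D x - - \<gamma> *\<^sub>R D y) \<le> \<gamma> * L * norm (x - y)"
      using lip[of x y] \<open>0 < \<gamma>\<close> by (simp add: mult.assoc)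
  qed (use assms in auto)
  have pR: "p \<in> ?R"
    using p \<open>0 < \<gamma>\<close> unfolding R_iff by (auto simp: set_plus_def algebra_simps)
  \<comment> \<open>Monotonicity of \<open>B + D\<close> bounds
    \<open>(norm (q - p))\<^sup>2\<close> by \<open>\<gamma> * L\<close> times itself.\<close>
  have "q = p" if "q \<in> ?R" for q
  proof -
    define u where "u = (1 / \<gamma>) *\<^sub>R (z - q)"
    define v where "v = (1 / \<gamma>) *\<^sub>R (z - p)"
    have "u + D q \<in> B q + {D q}" "v + D p \<in> B p + {D p}"
      using that pR unfolding R_iff u_def v_def by auto
    then have "0 \<le> (u + D q - (v + D p)) \<bullet> (q - p)"
      using max unfolding maximally_monotone_def monotone_op_def by blast
    then have "0 \<le> \<gamma> * ((u + D q - (v + D p)) \<bullet> (q - p))" using \<open>0 < \<gamma>\<close> by simp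
    also have "\<dots> = (\<gamma> *\<^sub>R (u - v)) \<bullet> (q - p) + \<gamma> * ((D q - D p) \<bullet> (q - p))"
      by (simp add: inner_simps algebra_simps)
    also have "\<gamma> *\<^sub>R (u - v) = - (q - p)"
      using \<open>0 < \<gamma>\<close> by (simp add: u_def v_def scaleR_diff_right)
    also have "- (q - p) \<bullet> (q - p) = - (norm (q - p))\<^sup>2"
      by (simp only: inner_minus_left power2_norm_eq_inner)
    finally have "0 \<le> - (norm (q - p))\<^sup>2 + \<gamma> * ((D q - D p) \<bullet> (q - p))" .
    also have "\<dots> \<le> - (norm (q - p))\<^sup>2 + \<gamma> * (L * norm (q - p) * norm (q - p))"
      using norm_cauchy_schwarz[of "D q - D p" "q - p"]
        mult_right_mono[OF lip[of q p], of "norm (q - p)"] \<open>0 < \<gamma>\<close> by simp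
    also have "\<dots> = (\<gamma> * L - 1) * (norm (q - p))\<^sup>2"
      by (simp add: power2_eq_square algebra_simps)
    finally have "0 \<le> (\<gamma> * L - 1) * (norm (q - p))\<^sup>2" .
    then have "(norm (q - p))\<^sup>2 \<le> 0" using \<open>\<gamma> * L < 1\<close> by (simp add: zero_le_mult_iff)
    then show ?thesis by simp
  qed
  with pR have "?R = {p}" by blast
  then have "resolvent \<gamma> B z = p" by (simp add: resolvent_def)
  with pR show ?thesis by (simp add: R_iff)
qed

section \<open>The forward-backward-forward iteration\<close>

text \<open>\<open>adjoint\<close> is a choice, so its identity is available once some adjoint
  exists; Riesz representation provides one. Skewness then equates \<open>K x \<bullet> x\<close>
  with its negative.\<close>

lemma skew_adjointD:
  fixes K :: "'a::{real_inner,complete_space} \<Rightarrow> 'a"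
  assumes "linear_skew_adjoint K"
  shows "bounded_linear K" "K x \<bullet> x = 0"
proof -
  show bl: "bounded_linear K" using assms by (simp add: linear_skew_adjoint_def)
  have "\<exists>l. \<forall>x. K x \<bullet> y = x \<bullet> l" for y
  proof -
    have "bounded_linear (\<lambda>x. K x \<bullet> y)"
      using bounded_linear_inner_left[of y] bl by (rule bounded_linear_compose)
    then obtain l where "\<And>x. K x \<bullet> y = l \<bullet> x" by (rule riesz_representation) blast
    then show ?thesis by (auto simp: inner_commute)
  qed
  then have "\<exists>K'. \<forall>x y. K x \<bullet> y = x \<bullet> K' y" by metis
  then have "\<forall>x y. K x \<bullet> y = x \<bullet> adjoint K y" unfolding adjoint_def by (rule someI_ex)
  then have "K x \<bullet> x = x \<bullet> (- K x)" using assms by (simp add: linear_skew_adjoint_def)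
  then show "K x \<bullet> x = 0" by (simp add: inner_commute)
qed

lemma inv_cocoercive_monotone:
  assumes "inv_cocoercive \<beta> E" "0 \<le> \<beta>"
  shows "0 \<le> (E x - E y) \<bullet> (x - y)"
proof (cases "\<beta> = 0")
  case True
  with assms(1) show ?thesis by (force simp: inv_cocoercive_def)
next
  case False
  have "0 \<le> (1 / \<beta>) * (norm (E x - E y))\<^sup>2" using assms(2) by simp
  also have "\<dots> \<le> (E x - E y) \<bullet> (x - y)" using assms(1) False by (simp add: inv_cocoercive_def)
  finally show ?thesis .
qed

text \<open>Young's inequality, weighted so that cocoercivity absorbs exactly
  \<open>(1 / \<beta>) * (norm (E x - E y))\<^sup>2\<close>. The constant \<open>\<beta> / 4\<close>
  becomes \<open>\<gamma> * \<beta> / 2\<close> in the Fejer estimate.\<close>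

lemma inv_cocoercive_young:
  assumes "inv_cocoercive \<beta> E" "0 \<le> \<beta>"
  shows "(E x - E y) \<bullet> d - (E x - E y) \<bullet> (x - y) \<le> \<beta> / 4 * (norm d)\<^sup>2"
proof (cases "\<beta> = 0")
  case True
  with assms(1) show ?thesis by (force simp: inv_cocoercive_def)
next
  case False
  then have "0 < \<beta>" using assms(2) by simp
  define n where "n = norm (E x - E y)"
  have "(1 / \<beta>) * n\<^sup>2 \<le> (E x - E y) \<bullet> (x - y)"
    using assms(1) False by (simp add: inv_cocoercive_def n_def)
  moreover have "(E x - E y) \<bullet> d \<le> n * norm d" unfolding n_def by (rule norm_cauchy_schwarz)
  moreover have "n * norm d \<le> (1 / \<beta>) * n\<^sup>2 + \<beta> / 4 * (norm d)\<^sup>2"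
  proof -
    have "0 \<le> (1 / \<beta>) * (n - \<beta> / 2 * norm d)\<^sup>2" using \<open>0 < \<beta>\<close> by simp
    also have "\<dots> = (1 / \<beta>) * n\<^sup>2 + \<beta> / 4 * (norm d)\<^sup>2 - n * norm d"
      using \<open>0 < \<beta>\<close> by (simp add: power2_eq_square field_simps)
    finally show ?thesis by simp
  qed
  ultimately show ?thesis by linarith
qed

lemma inv_cocoercive_lipschitz:
  assumes "inv_cocoercive \<beta> E" "0 \<le> \<beta>"
  shows "norm (E x - E y) \<le> \<beta> * norm (x - y)"
proof (cases "\<beta> = 0")
  case True
  with assms(1) show ?thesis by (force simp: inv_cocoercive_def)
next
  case False
  then have "0 < \<beta>" using assms(2) by simp
  have "(1 / \<beta>) * (norm (E x - E y))\<^sup>2 \<le> norm (E x - E y) * norm (x - y)"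
    using assms(1) False norm_cauchy_schwarz[of "E x - E y" "x - y"]
    by (auto simp: inv_cocoercive_def intro: order_trans)
  then have "norm (E x - E y) * norm (E x - E y) \<le> norm (E x - E y) * (\<beta> * norm (x - y))"
    using \<open>0 < \<beta>\<close> by (simp add: field_simps power2_eq_square)
  then show ?thesis
    using \<open>0 < \<beta>\<close> by (cases "norm (E x - E y) = 0") (auto simp: mult_le_cancel_left)
qed

section \<open>Fejer estimate and step size\<close>

text \<open>The correction makes \<open>(1 / \<gamma>) *\<^sub>R (x - x')\<close> an element of
  \<open>B + D + K\<close> at \<open>p\<close>, plus \<open>E x\<close>: only \<open>E\<close> stays
  at the old point. Monotonicity against \<open>z\<close> and cocoercivity then control
  \<open>(x - x') \<bullet> (p - z)\<close>.\<close>

lemma fbf_step: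
  fixes B :: "'a::real_inner \<Rightarrow> 'a set"
  assumes mono: "monotone_op (\<lambda>x. B x + {D x})"
    and skew: "\<And>x y. (K x - K y) \<bullet> (x - y) = 0"
    and lip: "\<And>x y. norm ((D x + K x) - (D y + K y)) \<le> L * norm (x - y)"
    and coc: "inv_cocoercive \<beta> E" "0 \<le> \<beta>" and "0 < \<gamma>" "0 \<le> L"
    and p: "(1 / \<gamma>) *\<^sub>R (x - \<gamma> *\<^sub>R (D x + K x + E x) - p) \<in> B p"
    and x': "x' = p - \<gamma> *\<^sub>R ((D p + K p) - (D x + K x))"
    and z: "0 \<in> B z + {D z} + {E z} + {K z}"
  shows "(norm (x' - z))\<^sup>2 \<le> (norm (x - z))\<^sup>2 - (1 - (\<gamma> * L)\<^sup>2 - \<gamma> * \<beta> / 2) * (norm (x - p))\<^sup>2"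
proof -
  let ?u = "(1 / \<gamma>) *\<^sub>R (x - \<gamma> *\<^sub>R (D x + K x + E x) - p)"
  obtain v where "v \<in> B z" "v + D z + E z + K z = 0"
    using z by (auto simp: set_plus_def intro: that[OF _ sym])
  then have v: "v \<in> B z" "v + D z = - E z - K z"
    by (simp_all add: eq_diff_eq eq_neg_iff_add_eq_0 ac_simps)
  have u_eq: "?u = (1 / \<gamma>) *\<^sub>R (x - p) - (D x + K x + E x)"
    using \<open>0 < \<gamma>\<close> by (simp add: scaleR_diff_right algebra_simps)
  have x'_eq: "(1 / \<gamma>) *\<^sub>R (x - x') = (1 / \<gamma>) *\<^sub>R (x - p) + ((D p + K p) - (D x + K x))"
    using \<open>0 < \<gamma>\<close> unfolding x' by (simp add: scaleR_diff_right scaleR_add_right)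
  have "?u + D p \<in> B p + {D p}" using p by auto
  moreover have "v + D z \<in> B z + {D z}" using v(1) by (intro set_plus_intro) auto
  ultimately have "0 \<le> (?u + D p - (v + D z)) \<bullet> (p - z)"
    using mono unfolding monotone_op_def by blast
  \<comment> \<open>The added term is 0 by skewness; it supplies the \<open>K p\<close> of the
    correction and the \<open>K z\<close> of the inclusion at \<open>z\<close>.\<close>
  also have "\<dots> = (?u + D p - (v + D z)) \<bullet> (p - z) + (K p - K z) \<bullet> (p - z)"
    by (simp add: skew)
  also have "\<dots> = ((1 / \<gamma>) *\<^sub>R (x - x') - (E x - E z)) \<bullet> (p - z)"
    unfolding v(2) x'_eq u_eq inner_add_left[symmetric] by (simp add: algebra_simps)
  finally have "0 \<le> \<gamma> * (((1 / \<gamma>) *\<^sub>R (x - x') - (E x - E z)) \<bullet> (p - z))"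
    using \<open>0 < \<gamma>\<close> by simp
  then have main: "\<gamma> * ((E x - E z) \<bullet> (p - z)) \<le> (x - x') \<bullet> (p - z)"
    using \<open>0 < \<gamma>\<close> by (simp add: inner_diff_left right_diff_distrib)
  have "(E x - E z) \<bullet> (x - p) - (E x - E z) \<bullet> (x - z) \<le> \<beta> / 4 * (norm (x - p))\<^sup>2"
    by (rule inv_cocoercive_young[OF coc])
  then have "- ((E x - E z) \<bullet> (p - z)) \<le> \<beta> / 4 * (norm (x - p))\<^sup>2"
    by (simp add: inner_diff_right)
  then have "\<gamma> * - ((E x - E z) \<bullet> (p - z)) \<le> \<gamma> * (\<beta> / 4 * (norm (x - p))\<^sup>2)"
    using \<open>0 < \<gamma>\<close> by (intro mult_left_mono) auto
  with main have 1: "- 2 * ((x - x') \<bullet> (p - z)) \<le> \<gamma> * \<beta> / 2 * (norm (x - p))\<^sup>2"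
    by simp
  have "norm (x' - p) = \<gamma> * norm ((D p + K p) - (D x + K x))"
    using \<open>0 < \<gamma>\<close> by (simp add: x')
  also have "\<dots> \<le> \<gamma> * L * norm (x - p)"
    using lip[of p x] \<open>0 < \<gamma>\<close> by (simp add: norm_minus_commute mult.assoc)
  finally have 2: "(norm (x' - p))\<^sup>2 \<le> (\<gamma> * L)\<^sup>2 * (norm (x - p))\<^sup>2"
    by (simp add: power_mono flip: power_mult_distrib)
  \<comment> \<open>Both squared distances to \<open>z\<close> are expanded around \<open>p\<close>
    and subtracted.\<close>
  have "(norm (x' - z))\<^sup>2 =
      (norm (x - z))\<^sup>2 - 2 * ((x - x') \<bullet> (p - z)) + (norm (x' - p))\<^sup>2 - (norm (x - p))\<^sup>2"
    unfolding power2_norm_eq_inner by (simp add: inner_simps inner_commute)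
  with 1 2 show ?thesis by (simp add: algebra_simps)
qed

text \<open>In terms of \<open>q = \<gamma> * (\<beta> + s)\<close>, with \<open>s\<close> the
  square root, 16 times the left side is
  \<open>q\<^sup>2 + 2 * (\<gamma> * \<beta>) * (4 - q)\<close>. As \<open>\<beta> \<le> s\<close>
  gives \<open>2 * (\<gamma> * \<beta>) \<le> q\<close>, this is at most \<open>4 * q\<close>. A
  vanishing denominator means \<open>q = 0\<close>.\<close>

lemma step_size_bound:
  fixes L \<beta> \<gamma> \<epsilon> :: real
  assumes "0 \<le> L" "0 \<le> \<beta>" "0 < \<gamma>" "0 < \<epsilon>" "\<epsilon> < 1"
    and step: "\<beta> + sqrt (\<beta>\<^sup>2 + 16 * L\<^sup>2) \<noteq> 0 \<Longrightarrow> \<gamma> \<le> (4 - \<epsilon>) / (\<beta> + sqrt (\<beta>\<^sup>2 + 16 * L\<^sup>2))"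
  shows "(\<gamma> * L)\<^sup>2 + \<gamma> * \<beta> / 2 \<le> 1 - \<epsilon> / 4"
proof -
  define s where "s = sqrt (\<beta>\<^sup>2 + 16 * L\<^sup>2)"
  have s2: "s\<^sup>2 = \<beta>\<^sup>2 + 16 * L\<^sup>2" by (simp add: s_def)
  have "\<beta> \<le> s" unfolding s_def by (rule real_le_rsqrt) simp
  define q where "q = \<gamma> * (\<beta> + s)"
  have "q \<le> 4 - \<epsilon>"
  proof (cases "\<beta> + s = 0")
    case False
    then have "0 < \<beta> + s" using \<open>0 \<le> \<beta>\<close> \<open>\<beta> \<le> s\<close> by linarith
    with step show ?thesis by (simp add: q_def s_def pos_le_divide_eq)
  qed (use \<open>\<epsilon> < 1\<close> in \<open>simp add: q_def\<close>)
  have q\<beta>: "2 * (\<gamma> * \<beta>) \<le> q"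
    using mult_left_mono[OF \<open>\<beta> \<le> s\<close>, of \<gamma>] \<open>0 < \<gamma>\<close> by (simp add: q_def algebra_simps)
  have "16 * (\<gamma> * L)\<^sup>2 = \<gamma>\<^sup>2 * (s\<^sup>2 - \<beta>\<^sup>2)" by (simp add: s2 power_mult_distrib)
  also have "\<dots> = q\<^sup>2 - 2 * (\<gamma> * \<beta>) * q" by (simp add: q_def power2_eq_square algebra_simps)
  finally have "16 * ((\<gamma> * L)\<^sup>2 + \<gamma> * \<beta> / 2) = q\<^sup>2 + 2 * (\<gamma> * \<beta>) * (4 - q)"
    by (simp add: algebra_simps)
  also have "\<dots> \<le> q\<^sup>2 + q * (4 - q)"
    using q\<beta> \<open>q \<le> 4 - \<epsilon>\<close> \<open>0 < \<epsilon>\<close> by (intro add_left_mono mult_right_mono) auto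
  also have "\<dots> = 4 * q" by (simp add: power2_eq_square algebra_simps)
  also have "\<dots> \<le> 16 * (1 - \<epsilon> / 4)" using \<open>q \<le> 4 - \<epsilon>\<close> by simp
  finally show ?thesis by (simp only: mult_le_cancel_left)
qed

text \<open>
  Instead of the maximality of \<open>T + C\<close>, the solvability of \<open>l \<in> q + \<mu> (T q + C q)\<close> is used directly:
  passing to the limit in the monotonicity inequality at \<open>q\<close> forces \<open>q = l\<close>.
\<close>

lemma zero_weak_cluster_point:
  fixes T :: "'a::{real_inner,complete_space} \<Rightarrow> 'a set"
  assumes max: "maximally_monotone T" and "0 \<le> c"
    and lip: "\<And>x y. norm (C x - C y) \<le> c * norm (x - y)"
    and mono: "\<And>x y. 0 \<le> (C x - C y) \<bullet> (x - y)"
    and "G \<noteq> bot"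
    and weak: "\<And>y. ((\<lambda>k. p k \<bullet> y) \<longlongrightarrow> l \<bullet> y) G"
    and bdd: "\<And>k. norm (p k) \<le> R"
    and r: "(r \<longlongrightarrow> 0) G" "\<And>k. r k - C (p k) \<in> T (p k)"
  shows "- C l \<in> T l"
proof -
  \<comment> \<open>This choice gives \<open>\<mu> * c < 1\<close>, so that the perturbed inclusion
    is solvable.\<close>
  define \<mu> where "\<mu> = 1 / (c + 1)"
  have "0 < \<mu>" using \<open>0 \<le> c\<close> by (simp add: \<mu>_def)
  obtain q w where w: "w \<in> T q" "q + \<mu> *\<^sub>R w + \<mu> *\<^sub>R C q = l"
  proof (rule minty_lipschitz[OF max \<open>0 < \<mu>\<close>, of "\<mu> * c" "\<lambda>x. \<mu> *\<^sub>R C x"])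
    show "norm (\<mu> *\<^sub>R C x - \<mu> *\<^sub>R C y) \<le> \<mu> * c * norm (x - y)" for x y
      using lip[of x y] \<open>0 < \<mu>\<close> by (simp add: mult.assoc flip: scaleR_diff_right)
  qed (use \<open>0 \<le> c\<close> in \<open>auto simp: \<mu>_def\<close>)
  define s where "s = w + C q"
  have ls: "l - q = \<mu> *\<^sub>R s" using w(2) by (simp add: s_def algebra_simps)
  have "0 \<le> (r k - s) \<bullet> (p k - q)" for k
  proof -
    have "0 \<le> (r k - C (p k) - w) \<bullet> (p k - q)"
      using r(2) w(1) max by (auto simp: maximally_monotone_def monotone_op_def)
    then show ?thesis using mono[of "p k" q] by (simp add: s_def inner_simps)
  qed
  \<comment> \<open>\<open>r\<close> tends to 0 strongly and meets a bounded factor; weak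
    convergence of \<open>p\<close> is tested only against the fixed \<open>s\<close>. By
    \<open>ls\<close> the limit is \<open>- \<mu>\<close> times
    \<open>s \<bullet> s\<close>.\<close>
  moreover have "((\<lambda>k. (r k - s) \<bullet> (p k - q)) \<longlongrightarrow> 0 - (l \<bullet> s - q \<bullet> s)) G"
  proof -
    have "((\<lambda>k. r k \<bullet> (p k - q)) \<longlongrightarrow> 0) G"
    proof (rule Lim_null_comparison)
      have "norm (r k \<bullet> (p k - q)) \<le> norm (r k) * (R + norm q)" for k
      proof -
        have "norm (p k - q) \<le> R + norm q" using norm_triangle_ineq4[of "p k" q] bdd[of k] by simp
        then show ?thesis
          using Cauchy_Schwarz_ineq2[of "r k" "p k - q"]
            mult_left_mono[of "norm (p k - q)" "R + norm q" "norm (r k)"] by simp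
      qed
      then show "\<forall>\<^sub>F k in G. norm (r k \<bullet> (p k - q)) \<le> norm (r k) * (R + norm q)" by simp
      show "((\<lambda>k. norm (r k) * (R + norm q)) \<longlongrightarrow> 0) G"
        using tendsto_mult[OF tendsto_norm[OF r(1)] tendsto_const, of "R + norm q"] by simp
    qed
    then have "((\<lambda>k. r k \<bullet> (p k - q) - (p k \<bullet> s - q \<bullet> s)) \<longlongrightarrow> 0 - (l \<bullet> s - q \<bullet> s)) G"
      by (intro tendsto_intros weak)
    then show ?thesis by (simp add: inner_simps inner_commute)
  qed
  ultimately have "0 \<le> 0 - (l \<bullet> s - q \<bullet> s)"
    using \<open>G \<noteq> bot\<close> by (intro tendsto_lowerbound) auto
  then have "(l - q) \<bullet> s \<le> 0" by (simp add: inner_diff_left)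
  then have "s \<bullet> s \<le> 0" using \<open>0 < \<mu>\<close> by (simp add: ls mult_le_0_iff)
  then have "s = 0" by (metis inner_eq_zero_iff inner_ge_zero order_antisym)
  with ls w(1) show ?thesis by (simp add: s_def eq_neg_iff_add_eq_0[symmetric])
qed

section \<open>Linear convergence under metric subregularity\<close>

text \<open>The Fejer inequality survives the infimum over \<open>Z\<close>, and the error bound
  makes its decrease a fixed fraction of the squared distance.\<close>

lemma linear_convergence:
  fixes x :: "nat \<Rightarrow> 'a::real_inner"
  assumes "Z \<noteq> {}" "0 < \<delta>" "0 \<le> C"
    and fejer: "\<And>z k. z \<in> Z \<Longrightarrow> (norm (x (Suc k) - z))\<^sup>2 \<le> (norm (x k - z))\<^sup>2 - \<delta> * (d k)\<^sup>2"
    and error: "\<And>k. K0 \<le> k \<Longrightarrow> infdist (x k) Z \<le> C * d k"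
    and lim: "x \<longlonglongrightarrow> xb"
  shows "locally_R_linear_to x xb" "locally_Q_linear_to_zero (\<lambda>k. infdist (x k) Z)"
proof -
  define a where "a k = infdist (x k) Z" for k
  have a0: "0 \<le> a k" for k by (simp add: a_def infdist_nonneg)
  have a_ge: "t \<le> a k" if "\<And>z. z \<in> Z \<Longrightarrow> t \<le> norm (x k - z)" for t k
    unfolding a_def infdist_notempty[OF \<open>Z \<noteq> {}\<close>]
    using \<open>Z \<noteq> {}\<close> that by (intro cINF_greatest) (auto simp: dist_norm)
  have dec: "(a (Suc k))\<^sup>2 \<le> (a k)\<^sup>2 - \<delta> * (d k)\<^sup>2" for k
  proof -
    \<comment> \<open>The square root gives a lower bound for \<open>norm (x k - z)\<close> uniform
      in \<open>z\<close>, the form in which the infimum can be taken.\<close>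
    have "sqrt ((a (Suc k))\<^sup>2 + \<delta> * (d k)\<^sup>2) \<le> a k"
    proof (rule a_ge)
      fix z assume "z \<in> Z"
      have "a (Suc k) \<le> norm (x (Suc k) - z)"
        unfolding a_def using infdist_le[OF \<open>z \<in> Z\<close>] by (simp add: dist_norm)
      then have "(a (Suc k))\<^sup>2 \<le> (norm (x (Suc k) - z))\<^sup>2" using a0 by (rule power_mono)
      with fejer[OF \<open>z \<in> Z\<close>, of k] show "sqrt ((a (Suc k))\<^sup>2 + \<delta> * (d k)\<^sup>2) \<le> norm (x k - z)"
        by (intro real_le_lsqrt) auto
    qed
    then have "(a (Suc k))\<^sup>2 + \<delta> * (d k)\<^sup>2 \<le> (a k)\<^sup>2" by (rule sqrt_le_D)
    then show ?thesis by simp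
  qed
  \<comment> \<open>Enlarging \<open>C\<close> to \<open>M\<close> preserves the error bound and
    makes division by \<open>M\<^sup>2\<close> safe.\<close>
  define M where "M = C + 1 + \<delta>"
  have "\<delta> < M\<^sup>2"
  proof -
    have "M * 1 \<le> M * M" using \<open>0 \<le> C\<close> \<open>0 < \<delta>\<close> by (intro mult_left_mono) (auto simp: M_def)
    then show ?thesis using \<open>0 \<le> C\<close> by (simp add: M_def power2_eq_square)
  qed
  have "0 < M" using \<open>0 \<le> C\<close> \<open>0 < \<delta>\<close> by (simp add: M_def)
  \<comment> \<open>The maximum with \<open>1/2\<close> keeps \<open>c\<close> positive, since the
    R-linear constant divides by \<open>c ^ K0\<close>.\<close>
  define c where "c = max (1/2) (sqrt (1 - \<delta> / M\<^sup>2))"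
  have c: "0 < c" "c < 1"
    using \<open>0 < \<delta>\<close> \<open>0 < M\<close> by (auto simp: c_def real_sqrt_lt_1_iff)
  have contr: "a (Suc k) \<le> c * a k" if "K0 \<le> k" for k
  proof -
    have "a k \<le> M * \<bar>d k\<bar>"
    proof -
      have "a k \<le> C * d k" using error[OF that] by (simp add: a_def)
      also have "\<dots> \<le> C * \<bar>d k\<bar>" using \<open>0 \<le> C\<close> by (intro mult_left_mono) auto
      also have "\<dots> \<le> M * \<bar>d k\<bar>" using \<open>0 < \<delta>\<close> by (intro mult_right_mono) (auto simp: M_def)
      finally show ?thesis .
    qed
    then have "(a k)\<^sup>2 \<le> (M * \<bar>d k\<bar>)\<^sup>2" using a0 by (rule power_mono)
    then have "(a k)\<^sup>2 / M\<^sup>2 \<le> (d k)\<^sup>2"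
      using \<open>0 < M\<close> by (simp add: power_mult_distrib divide_le_eq mult.commute)
    then have "\<delta> * ((a k)\<^sup>2 / M\<^sup>2) \<le> \<delta> * (d k)\<^sup>2"
      using \<open>0 < \<delta>\<close> by (intro mult_left_mono) auto
    with dec[of k] have "(a (Suc k))\<^sup>2 \<le> (1 - \<delta> / M\<^sup>2) * (a k)\<^sup>2" by (simp add: left_diff_distrib)
    then have "a (Suc k) \<le> sqrt ((1 - \<delta> / M\<^sup>2) * (a k)\<^sup>2)" by (rule real_le_rsqrt)
    also have "\<dots> = sqrt (1 - \<delta> / M\<^sup>2) * a k" using a0 by (simp add: real_sqrt_mult)
    also have "\<dots> \<le> c * a k" using a0 by (intro mult_right_mono) (auto simp: c_def)
    finally show ?thesis .
  qed
  show "locally_Q_linear_to_zero (\<lambda>k. infdist (x k) Z)"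
    unfolding locally_Q_linear_to_zero_def a_def[symmetric]
    using a0 contr c by (intro conjI exI[of _ K0] bexI[of _ c]) auto
  have decseq: "decseq (\<lambda>k. norm (x k - z))" if "z \<in> Z" for z
  proof (rule decseq_SucI)
    fix k
    have "0 \<le> \<delta> * (d k)\<^sup>2" using \<open>0 < \<delta>\<close> by simp
    with fejer[OF that, of k] have "(norm (x (Suc k) - z))\<^sup>2 \<le> (norm (x k - z))\<^sup>2" by linarith
    then show "norm (x (Suc k) - z) \<le> norm (x k - z)" by (rule power2_le_imp_le) simp
  qed
  \<comment> \<open>For \<open>n \<ge> k\<close> both \<open>x k\<close> and \<open>x n\<close> lie
    within \<open>norm (x k - z)\<close> of every \<open>z\<close> in \<open>Z\<close>; take the
    infimum over \<open>z\<close>, then let \<open>n\<close> tend to infinity.\<close>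
  have near: "norm (x k - xb) \<le> 2 * a k" for k
  proof -
    have "norm (x k - x n) / 2 \<le> a k" if "k \<le> n" for n
    proof (rule a_ge)
      fix z assume "z \<in> Z"
      have "norm (x k - x n) \<le> norm (x k - z) + norm (x n - z)"
        using norm_triangle_ineq4[of "x k - z" "x n - z"] by simp
      also have "norm (x n - z) \<le> norm (x k - z)" using decseqD[OF decseq[OF \<open>z \<in> Z\<close>] that] .
      finally show "norm (x k - x n) / 2 \<le> norm (x k - z)" by simp
    qed
    then have "\<forall>\<^sub>F n in sequentially. norm (x k - x n) \<le> 2 * a k"
      unfolding eventually_sequentially by (intro exI[of _ k]) (auto simp: mult.commute)
    moreover have "(\<lambda>n. norm (x k - x n)) \<longlonglongrightarrow> norm (x k - xb)" by (intro tendsto_intros lim)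
    ultimately show ?thesis by (intro tendsto_upperbound) auto
  qed
  have geo: "a (K0 + n) \<le> a K0 * c ^ n" for n
  proof (induction n)
    case (Suc n)
    have "a (K0 + Suc n) \<le> c * a (K0 + n)" using contr[of "K0 + n"] by simp
    also have "\<dots> \<le> c * (a K0 * c ^ n)" using Suc c by simp
    finally show ?case by (simp add: algebra_simps)
  qed simp
  have "norm (x k - xb) \<le> 2 * a K0 / c ^ K0 * c ^ k" if "K0 \<le> k" for k
  proof -
    have "norm (x k - xb) \<le> 2 * (a K0 * c ^ (k - K0))"
      using near[of k] geo[of "k - K0"] that by simp
    also have "\<dots> = 2 * a K0 / c ^ K0 * c ^ k" using c that by (simp add: power_diff)
    finally show ?thesis .
  qed
  then show "locally_R_linear_to x xb"
    unfolding locally_R_linear_to_def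
    using a0[of K0] c by (intro exI[of _ K0] exI[of _ "2 * a K0 / c ^ K0"] conjI bexI[of _ c]) auto
qed

text \<open>Eventually \<open>p k\<close> and \<open>r k\<close> enter the two neighbourhoods, and
  then \<open>r k\<close> itself bounds the distance from 0 to
  \<open>F (p k) \<inter> V\<close>.\<close>

lemma metrically_subregular_error_bound:
  fixes F :: "'a::real_normed_vector \<Rightarrow> 'a set"
  assumes "metrically_subregular F xb 0" "p \<longlonglongrightarrow> xb" "r \<longlonglongrightarrow> 0" "\<And>k. r k \<in> F (p k)"
  obtains \<kappa> where "0 \<le> \<kappa>" "\<forall>\<^sub>F k in sequentially. infdist (p k) (zer F) \<le> \<kappa> * norm (r k)"
proof -
  obtain \<kappa> U V where "0 \<le> \<kappa>" and U: "xb \<in> interior U" and V: "0 \<in> interior V"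
    and bound: "\<And>x. x \<in> U \<Longrightarrow> ext_dist x (op_inverse F 0) \<le> ereal \<kappa> * ext_dist 0 (F x \<inter> V)"
    using assms(1) unfolding metrically_subregular_def by blast
  have "\<forall>\<^sub>F k in sequentially. p k \<in> interior U"
    using assms(2) U by (intro topological_tendstoD) auto
  moreover have "\<forall>\<^sub>F k in sequentially. r k \<in> interior V"
    using assms(3) V by (intro topological_tendstoD) auto
  ultimately have "\<forall>\<^sub>F k in sequentially. infdist (p k) (zer F) \<le> \<kappa> * norm (r k)"
  proof eventually_elim
    case (elim k)
    then have "p k \<in> U" "r k \<in> F (p k) \<inter> V" using assms(4) interior_subset by blast+
    have "op_inverse F 0 = zer F" by (auto simp: op_inverse_def zer_def)
    then have "ereal (infdist (p k) (zer F)) \<le> ext_dist (p k) (op_inverse F 0)"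
      unfolding ext_dist_def by (intro INF_greatest) (simp add: infdist_le)
    also have "\<dots> \<le> ereal \<kappa> * ext_dist 0 (F (p k) \<inter> V)" by (rule bound) fact
    also have "\<dots> \<le> ereal \<kappa> * ereal (dist 0 (r k))"
      unfolding ext_dist_def using \<open>0 \<le> \<kappa>\<close> \<open>r k \<in> F (p k) \<inter> V\<close>
      by (intro ereal_mult_left_mono INF_lower) auto
    finally show ?case by simp
  qed
  with \<open>0 \<le> \<kappa>\<close> show ?thesis using that by blast
qed

section \<open>Weak and linear convergence of the iteration\<close>

theorem theorem5:
  fixes B A :: "'a::{real_inner,complete_space} \<Rightarrow> 'a set"
    and D E K :: "'a \<Rightarrow> 'a"
    and L\<^sub>D \<beta>\<^sub>E \<epsilon> :: real
    and \<gamma> :: "nat \<Rightarrow> real"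
    and x xh :: "nat \<Rightarrow> 'a"
  assumes "L\<^sub>D \<ge> 0" and "\<beta>\<^sub>E \<ge> 0"
    and "L\<^sub>D-lipschitz_on UNIV D"
    and "inv_cocoercive \<beta>\<^sub>E E"
    and "linear_skew_adjoint K"
    and "maximally_monotone (\<lambda>x. B x + {D x})"
    and A: "A = (\<lambda>x. B x + {D x} + {E x} + {K x})"
    and "zer A \<noteq> {}"
    and "0 < \<epsilon>" and "\<epsilon> < 1"
    and "\<And>k. \<gamma> k \<in> {\<epsilon>..1 / \<epsilon>}"
    and "\<And>k. \<beta>\<^sub>E + sqrt (\<beta>\<^sub>E\<^sup>2 + 16 * (L\<^sub>D + onorm K)\<^sup>2) \<noteq> 0 \<Longrightarrow>
           \<gamma> k \<le> (4 - \<epsilon>) / (\<beta>\<^sub>E + sqrt (\<beta>\<^sub>E\<^sup>2 + 16 * (L\<^sub>D + onorm K)\<^sup>2))"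
    and "\<And>k. xh k = resolvent (\<gamma> k) B (x k - \<gamma> k *\<^sub>R (D (x k) + K (x k) + E (x k)))"
    and "\<And>k. x (Suc k) = xh k - \<gamma> k *\<^sub>R ((D (xh k) + K (xh k)) - (D (x k) + K (x k)))"
  shows "\<exists>xb\<in>zer A. weakly_convergent_to x xb \<and>
    ((\<forall>z\<in>zer A. metrically_subregular A z 0) \<and> (\<exists>S::'a set. finite S \<and> span S = UNIV)
      \<longrightarrow> locally_R_linear_to x xb \<and> locally_Q_linear_to_zero (\<lambda>k. infdist (x k) (zer A)))"
proof -
  note lipD = assms(3) and coc = assms(4,2) and max = assms(6)
    and x_step = assms(14)
  define L where "L = L\<^sub>D + onorm K"
  \<comment> \<open>\<open>M\<close> is the part corrected in the second step, \<open>C\<close> the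
    monotone Lipschitz part added to \<open>B + D\<close>; \<open>K\<close> belongs to both.\<close>
  define M where "M y = D y + K y" for y
  define C where "C y = E y + K y" for y
  note K = skew_adjointD[OF assms(5)]
  interpret K: bounded_linear K by (rule K(1))
  have skew: "(K y - K z) \<bullet> (y - z) = 0" for y z
    using K(2)[of "y - z"] by (simp add: K.diff)
  have lip_D: "norm (D y - D z) \<le> L\<^sub>D * norm (y - z)" for y z
    using lipschitz_onD[OF lipD, of y z] by (simp add: dist_norm)
  have lip_K: "norm (K y - K z) \<le> onorm K * norm (y - z)" for y z
    using onorm[OF K(1), of "y - z"] by (simp add: K.diff)
  note lip_E = inv_cocoercive_lipschitz[OF coc]
  have "0 \<le> onorm K" by (rule onorm_pos_le[OF K(1)])
  then have L: "0 \<le> L" "L\<^sub>D \<le> L" using assms(1) by (simp_all add: L_def)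
  have lip_M: "norm (M y - M z) \<le> L * norm (y - z)" for y z
    using norm_triangle_ineq[of "D y - D z" "K y - K z"] lip_D[of y z] lip_K[of y z]
    by (simp add: M_def L_def algebra_simps)
  have lip_C: "norm (C y - C z) \<le> (\<beta>\<^sub>E + onorm K) * norm (y - z)" for y z
    using norm_triangle_ineq[of "E y - E z" "K y - K z"] lip_E[of y z] lip_K[of y z]
    by (simp add: C_def algebra_simps)
  have mono_C: "0 \<le> (C y - C z) \<bullet> (y - z)" for y z
    using inv_cocoercive_monotone[OF coc, of y z] skew[of y z]
    by (simp add: C_def inner_diff_left inner_add_left)
  have \<gamma>: "0 < \<gamma> k" "1 / \<gamma> k \<le> 1 / \<epsilon>" for k
  proof -
    have "\<epsilon> \<le> \<gamma> k" using assms(11)[of k] by simp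
    with assms(9) show "0 < \<gamma> k" "1 / \<gamma> k \<le> 1 / \<epsilon>"
      by (auto intro!: divide_left_mono)
  qed
  have step: "(\<gamma> k * L)\<^sup>2 + \<gamma> k * \<beta>\<^sub>E / 2 \<le> 1 - \<epsilon> / 4" for k
    using step_size_bound[OF L(1) assms(2) \<gamma>(1) assms(9,10)] assms(12)[of k] by (simp add: L_def)
  \<comment> \<open>The step-size estimate also yields the smallness that makes the resolvent well
    defined.\<close>
  have small: "\<gamma> k * L\<^sub>D < 1" for k
  proof -
    have "0 \<le> \<gamma> k * \<beta>\<^sub>E / 2" using \<gamma>(1)[of k] assms(2) by simp
    then have "(\<gamma> k * L)\<^sup>2 < 1\<^sup>2" using step[of k] assms(9) by simp
    then have "\<gamma> k * L < 1" by (rule power2_less_imp_less) simp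
    moreover have "\<gamma> k * L\<^sub>D \<le> \<gamma> k * L" using L(2) \<gamma>(1)[of k] by simp
    ultimately show ?thesis by simp
  qed
  define u where "u k = (1 / \<gamma> k) *\<^sub>R (x k - \<gamma> k *\<^sub>R (D (x k) + K (x k) + E (x k)) - xh k)" for k
  have uB: "u k \<in> B (xh k)" for k
    using resolvent_hypomonotone[OF max lip_D assms(1) \<gamma>(1) small, of k
      "x k - \<gamma> k *\<^sub>R (D (x k) + K (x k) + E (x k))"]
    unfolding u_def assms(13)[of k, symmetric] .
  define d where "d k = norm (x k - xh k)" for k
  have fejer: "(norm (x (Suc k) - z))\<^sup>2 \<le> (norm (x k - z))\<^sup>2 - \<epsilon> / 4 * (d k)\<^sup>2" if "z \<in> zer A" for z k
  proof -
    have "(norm (x (Suc k) - z))\<^sup>2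
        \<le> (norm (x k - z))\<^sup>2 - (1 - (\<gamma> k * L)\<^sup>2 - \<gamma> k * \<beta>\<^sub>E / 2) * (norm (x k - xh k))\<^sup>2"
    proof (rule fbf_step)
      show "monotone_op (\<lambda>x. B x + {D x})" using max by (simp add: maximally_monotone_def)
      show "0 \<in> B z + {D z} + {E z} + {K z}" using that by (simp add: A zer_def)
    qed (use skew lip_M coc \<gamma>(1) L(1) uB x_step in \<open>auto simp: M_def u_def\<close>)
    moreover have "\<epsilon> / 4 * (d k)\<^sup>2 \<le> (1 - (\<gamma> k * L)\<^sup>2 - \<gamma> k * \<beta>\<^sub>E / 2) * (norm (x k - xh k))\<^sup>2"
    proof -
      have "\<epsilon> / 4 \<le> 1 - (\<gamma> k * L)\<^sup>2 - \<gamma> k * \<beta>\<^sub>E / 2" using step[of k] by linarith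
      then show ?thesis unfolding d_def by (rule mult_right_mono) simp
    qed
    ultimately show ?thesis by linarith
  qed
  have fejer': "norm (x (Suc k) - z) \<le> norm (x k - z)" if "z \<in> zer A" for z k
  proof (rule power2_le_imp_le)
    have "0 \<le> \<epsilon> / 4 * (d k)\<^sup>2" using assms(9) by simp
    with fejer[OF that, of k] show "(norm (x (Suc k) - z))\<^sup>2 \<le> (norm (x k - z))\<^sup>2" by linarith
  qed simp
  obtain z0 where z0: "z0 \<in> zer A" using assms(8) by blast
  have "decseq (\<lambda>k. norm (x k - z0))" using fejer'[OF z0] by (rule decseq_SucI)
  then obtain a where a: "(\<lambda>k. norm (x k - z0)) \<longlonglongrightarrow> a"
    using decseq_convergent[of _ 0] by (metis norm_ge_zero)
  have d_lim: "d \<longlonglongrightarrow> 0"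
  proof -
    \<comment> \<open>The squared residuals are dominated by differences of consecutive terms of a
      convergent sequence.\<close>
    have "(\<lambda>k. 4 / \<epsilon> * ((norm (x k - z0))\<^sup>2 - (norm (x (Suc k) - z0))\<^sup>2)) \<longlonglongrightarrow> 4 / \<epsilon> * (a\<^sup>2 - a\<^sup>2)"
      by (intro tendsto_intros a LIMSEQ_Suc[OF a])
    moreover have "norm ((d k)\<^sup>2) \<le> 4 / \<epsilon> * ((norm (x k - z0))\<^sup>2 - (norm (x (Suc k) - z0))\<^sup>2)" for k
      using fejer[OF z0, of k] assms(9) by (simp add: field_simps)
    ultimately have "(\<lambda>k. (d k)\<^sup>2) \<longlonglongrightarrow> 0"
      by (intro Lim_null_comparison[of "\<lambda>k. (d k)\<^sup>2"]) auto
    then show ?thesis by simp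
  qed
  then have diff_lim: "(\<lambda>k. x k - xh k) \<longlonglongrightarrow> 0" unfolding d_def by (rule tendsto_norm_zero_cancel)
  define r where "r k = u k + D (xh k) + C (xh k)" for k
  have rA: "r k \<in> A (xh k)" for k
  proof -
    have "u k + D (xh k) + E (xh k) + K (xh k) \<in> A (xh k)"
      unfolding A using uB[of k] by (intro set_plus_intro) auto
    then show ?thesis by (simp add: r_def C_def add.assoc)
  qed
  have r_le: "norm (r k) \<le> (1 / \<epsilon> + L + \<beta>\<^sub>E) * d k" for k
  proof -
    \<comment> \<open>Expanding \<open>u k\<close> leaves in \<open>r k\<close> only multiples of
      \<open>x k - xh k\<close> and differences of Lipschitz maps between the two points.\<close>
    have "u k = (1 / \<gamma> k) *\<^sub>R (x k - xh k) - (D (x k) + K (x k) + E (x k))"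
      using \<gamma>(1)[of k] by (simp add: u_def scaleR_diff_right algebra_simps)
    then have "r k = (1 / \<gamma> k) *\<^sub>R (x k - xh k) + (M (xh k) - M (x k)) + (E (xh k) - E (x k))"
      by (simp add: r_def M_def C_def)
    then have "norm (r k) \<le> norm ((1 / \<gamma> k) *\<^sub>R (x k - xh k)) + norm (M (xh k) - M (x k))
        + norm (E (xh k) - E (x k))"
      by (simp only: norm_triangle_mono[OF norm_triangle_ineq order_refl] norm_triangle_ineq)
    moreover have "norm ((1 / \<gamma> k) *\<^sub>R (x k - xh k)) \<le> 1 / \<epsilon> * d k"
      using mult_right_mono[OF \<gamma>(2)[of k], of "d k"] \<gamma>(1)[of k] by (simp add: d_def)
    ultimately show ?thesis
      using lip_M[of "xh k" "x k"] lip_E[of "xh k" "x k"]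
      by (simp add: d_def norm_minus_commute algebra_simps)
  qed
  have r_lim: "r \<longlonglongrightarrow> 0"
    by (rule Lim_null_comparison[OF always_eventually[OF allI[OF r_le]]])
      (use tendsto_mult[OF tendsto_const d_lim, of "1 / \<epsilon> + L + \<beta>\<^sub>E"] in simp)
  have "Bseq (\<lambda>k. norm (x k - z0))" using a convergentI convergent_imp_Bseq by blast
  then obtain R1 where R1: "\<And>k. norm (x k - z0) \<le> R1" by (auto simp: Bseq_def)
  have "Bseq d" using d_lim convergentI convergent_imp_Bseq by blast
  then obtain R2 where R2: "\<And>k. d k \<le> R2" by (auto simp: Bseq_def d_def)
  have bdd: "norm (xh k) \<le> R1 + norm z0 + R2" for k
    using R1[of k] R2[of k] norm_triangle_ineq[of "x k - z0" z0] norm_triangle_ineq4[of "x k" "x k - xh k"]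
    by (simp add: d_def)
  obtain xb where xb: "xb \<in> zer A" "weakly_convergent_to x xb"
  proof (rule opial[where x = x, OF assms(8) fejer'])
    fix G l
    assume G: "G \<le> sequentially" "G \<noteq> bot" and l: "\<And>y. ((\<lambda>k. x k \<bullet> y) \<longlongrightarrow> l \<bullet> y) G"
    \<comment> \<open>\<open>xh\<close> has the same weak limit along \<open>G\<close> as
      \<open>x\<close>, because \<open>x k - xh k\<close> tends to 0.\<close>
    have "- C l \<in> B l + {D l}"
    proof (rule zero_weak_cluster_point[where C = C and p = xh, OF max _ lip_C mono_C G(2) _ bdd tendsto_mono[OF G(1) r_lim]])
      show "0 \<le> \<beta>\<^sub>E + onorm K" using assms(2) \<open>0 \<le> onorm K\<close> by simp
      show "((\<lambda>k. xh k \<bullet> y) \<longlongrightarrow> l \<bullet> y) G" for y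
      proof -
        have "((\<lambda>k. x k \<bullet> y - (x k - xh k) \<bullet> y) \<longlongrightarrow> l \<bullet> y - 0 \<bullet> y) G"
          by (intro tendsto_intros l tendsto_mono[OF G(1) diff_lim])
        then show ?thesis by (simp add: inner_diff_left)
      qed
      show "r k - C (xh k) \<in> B (xh k) + {D (xh k)}" for k
        using uB[of k] by (auto simp: r_def)
    qed
    then have "- C l + E l + K l \<in> A l" unfolding A by (intro set_plus_intro) auto
    then show "l \<in> zer A" by (simp add: C_def zer_def)
  qed
  moreover have "locally_R_linear_to x xb \<and> locally_Q_linear_to_zero (\<lambda>k. infdist (x k) (zer A))"
    if sub: "\<forall>z\<in>zer A. metrically_subregular A z 0" and fin: "\<exists>S::'a set. finite S \<and> span S = UNIV"
  proof -
    \<comment> \<open>Strong convergence brings \<open>xh k\<close> into the neighbourhood of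
      \<open>xb\<close> on which subregularity gives a bound.\<close>
    have strong: "x \<longlonglongrightarrow> xb" using fin xb(2) weak_imp_strong_finite_span by blast
    have "xh \<longlonglongrightarrow> xb" using tendsto_diff[OF strong diff_lim] by simp
    then obtain \<kappa> where "0 \<le> \<kappa>" and "\<forall>\<^sub>F k in sequentially. infdist (xh k) (zer A) \<le> \<kappa> * norm (r k)"
      using metrically_subregular_error_bound[of A xb xh r] sub xb(1) r_lim rA by blast
    then obtain K0 where K0: "\<And>k. K0 \<le> k \<Longrightarrow> infdist (xh k) (zer A) \<le> \<kappa> * norm (r k)"
      by (auto simp: eventually_sequentially)
    \<comment> \<open>The summand 1 pays for moving from \<open>xh k\<close> to \<open>x k\<close>;
      the rest combines \<kappa> with the residual bound \<open>r_le\<close>.\<close>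
    define c where "c = 1 + \<kappa> * (1 / \<epsilon> + L + \<beta>\<^sub>E)"
    have error: "infdist (x k) (zer A) \<le> c * d k" if "K0 \<le> k" for k
    proof -
      have "infdist (x k) (zer A) \<le> infdist (xh k) (zer A) + dist (x k) (xh k)"
        by (rule infdist_triangle)
      also have "\<dots> \<le> \<kappa> * ((1 / \<epsilon> + L + \<beta>\<^sub>E) * d k) + d k"
        using K0[OF that] mult_left_mono[OF r_le[of k] \<open>0 \<le> \<kappa>\<close>] by (simp add: dist_norm d_def)
      also have "\<dots> = c * d k" by (simp add: c_def algebra_simps)
      finally show ?thesis .
    qed
    have "0 < \<epsilon> / 4" "0 \<le> c" using assms(2,9) L(1) \<open>0 \<le> \<kappa>\<close> by (simp_all add: c_def)
    from linear_convergence[where x = x and d = d, OF assms(8) this fejer error strong] show ?thesis by blast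
  qed
  ultimately show ?thesis by blast
qed

end
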